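(* Let $\Omega$ be a completely regular Hausdorff topological space and let $(f_\alpha)$ be a net in $C(\Omega)_+$. Then $(f_\alpha)$ unbounded order converges (uo-converges) to $0$ in $C(\Omega)$ if and only if for every non-empty open set $U\subseteq\Omega$ and every $\varepsilon>0$ there exist a non-empty open set $V\subseteq U$ and an index $\alpha_0$ such that $f_\alpha(t)<\varepsilon$ for all $t\in V$ and all $\alpha\geqslant\alpha_0$.
   Context: $C(\Omega)$ is the vector lattice of all real-valued continuous functions on $\Omega$ with pointwise operations and order, and $C(\Omega)_+$ is the set of its non-negative elements. A net $(x_\alpha)$ in a vector lattice $X$ converges in order to $x$ if there is a net $(u_\gamma)$ in $X$, possibly with a different index set, such that $u_\gamma\downarrow 0$ (decreasing with infimum $0$ in $X$) and for every $\gamma$ there exists $\alpha_0$ with $|x_\alpha-x|\leqslant u_\gamma$ for all $\alpha\geqslant\alpha_0$. The net uo-converges to $x$ if for every $u\geqslant 0$ in $X$ the net $(|x_\alpha-x|\wedge u)$ converges in order to $0$. *)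

theory Defs
  imports "HOL-Analysis.Analysis" "HOL-Library.Function_Algebras"
begin

text \<open>
  Index sets of nets. A relation is a set of pairs; \<open>(a, b) \<in> r\<close> reads \<open>a \<le> b\<close>.
\<close>

definition directed_on :: "'i set \<Rightarrow> 'i rel \<Rightarrow> bool" where
  "directed_on A r \<longleftrightarrow> A \<noteq> {} \<and> preorder_on A r \<and>
     (\<forall>a\<in>A. \<forall>b\<in>A. \<exists>c\<in>A. (a, c) \<in> r \<and> (b, c) \<in> r)"

text \<open>
  In the following, \<open>L\<close> is a vector lattice that is given as a linear sublattice of an ambient
  lattice-ordered group, so that order and operations are those of the ambient type, whereas
  infima of sets are taken relative to \<open>L\<close>.
\<close>

definition lattice_abs :: "'v::{lattice, ordered_ab_group_add} \<Rightarrow> 'v" where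
  "lattice_abs x = sup x (- x)"

definition is_inf_in :: "'v::order set \<Rightarrow> 'v set \<Rightarrow> 'v \<Rightarrow> bool" where
  "is_inf_in L D m \<longleftrightarrow> m \<in> L \<and> (\<forall>d\<in>D. m \<le> d) \<and> (\<forall>z\<in>L. (\<forall>d\<in>D. z \<le> d) \<longrightarrow> z \<le> m)"

definition net_decreasing_to ::
  "'v::order set \<Rightarrow> 'g set \<Rightarrow> 'g rel \<Rightarrow> ('g \<Rightarrow> 'v) \<Rightarrow> 'v \<Rightarrow> bool" where
  "net_decreasing_to L G s u m \<longleftrightarrow>
     directed_on G s \<and> u ` G \<subseteq> L \<and>
     (\<forall>a b. (a, b) \<in> s \<longrightarrow> u b \<le> u a) \<and> is_inf_in L (u ` G) m"

text \<open>
  HOL cannot quantify over the type of the index set \<open>G\<close> of the dominating net, so \<open>G\<close> ranges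
  over the subsets of \<open>'v\<close>. This is no restriction, because a decreasing net can be reindexed
  by its own range: see \<open>order_convergesI\<close> below.
\<close>

definition order_converges ::
  "'v::{lattice, ordered_ab_group_add} set \<Rightarrow> 'i set \<Rightarrow> 'i rel \<Rightarrow> ('i \<Rightarrow> 'v) \<Rightarrow> 'v \<Rightarrow> bool" where
  "order_converges L A r x l \<longleftrightarrow>
     (\<exists>(G :: 'v set) s u. net_decreasing_to L G s u 0 \<and>
       (\<forall>g\<in>G. \<exists>a0\<in>A. \<forall>a\<in>A. (a0, a) \<in> r \<longrightarrow> lattice_abs (x a - l) \<le> u g))"

definition uo_converges ::
  "'v::{lattice, ordered_ab_group_add} set \<Rightarrow> 'i set \<Rightarrow> 'i rel \<Rightarrow> ('i \<Rightarrow> 'v) \<Rightarrow> 'v \<Rightarrow> bool" where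
  "uo_converges L A r x l \<longleftrightarrow>
     (\<forall>v\<in>L. 0 \<le> v \<longrightarrow> order_converges L A r (\<lambda>a. inf (lattice_abs (x a - l)) v) 0)"

lemma order_convergesI:
  fixes L :: "'v::{lattice, ordered_ab_group_add} set" and G :: "'g set"
  assumes u: "net_decreasing_to L G s u 0"
    and dom: "\<forall>g\<in>G. \<exists>a0\<in>A. \<forall>a\<in>A. (a0, a) \<in> r \<longrightarrow> lattice_abs (x a - l) \<le> u g"
  shows "order_converges L A r x l"
proof -
  let ?H = "u ` G"
  let ?t = "{(y, z). y \<in> ?H \<and> z \<in> ?H \<and> z \<le> y}"
  have "directed_on ?H ?t"
    unfolding directed_on_def
  proof (intro conjI ballI)
    show "?H \<noteq> {}"
      using u by (auto simp: net_decreasing_to_def directed_on_def)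
    show "preorder_on ?H ?t"
      by (auto simp: preorder_on_def refl_on_def trans_def)
    fix y z assume "y \<in> ?H" "z \<in> ?H"
    then obtain g h where gh: "g \<in> G" "h \<in> G" "y = u g" "z = u h" by auto
    then obtain k where "k \<in> G" "(g, k) \<in> s" "(h, k) \<in> s"
      using u unfolding net_decreasing_to_def directed_on_def by blast
    then show "\<exists>w\<in>?H. (y, w) \<in> ?t \<and> (z, w) \<in> ?t"
      using u gh by (auto simp: net_decreasing_to_def intro!: bexI[of _ k])
  qed
  then have "net_decreasing_to L ?H ?t id 0"
    using u by (auto simp: net_decreasing_to_def)
  then show ?thesis
    using dom unfolding order_converges_def by (intro exI[of _ ?H] exI[of _ ?t] exI[of _ id]) auto
qed

text \<open>
  \<open>C(\<Omega>)\<close> for \<open>\<Omega> = topspace X\<close>. HOL functions are total; each continuous function on \<open>\<Omega>\<close> is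
  represented by its unique extension that is \<open>0\<close> off \<open>\<Omega>\<close>. With this choice the pointwise order
  and operations of the function type restrict to those of \<open>C(\<Omega>)\<close>.
\<close>

definition cont_fun :: "'a topology \<Rightarrow> ('a \<Rightarrow> real) set" where
  "cont_fun X = {f. continuous_map X euclideanreal f \<and> (\<forall>t. t \<notin> topspace X \<longrightarrow> f t = 0)}"

definition cont_fun_nonneg :: "'a topology \<Rightarrow> ('a \<Rightarrow> real) set" where
  "cont_fun_nonneg X = {f \<in> cont_fun X. 0 \<le> f}"

lemma cont_fun_vector_sublattice:
  assumes "f \<in> cont_fun X" "g \<in> cont_fun X"
  shows "0 \<in> cont_fun X" "f + g \<in> cont_fun X" "- f \<in> cont_fun X"
    "(\<lambda>t. c * f t) \<in> cont_fun X" "sup f g \<in> cont_fun X" "inf f g \<in> cont_fun X"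
  using assms
  by (auto simp: cont_fun_def plus_fun_def zero_fun_def fun_Compl_def sup_fun_def inf_fun_def
      sup_real_def inf_real_def
      intro!: continuous_map_add continuous_map_minus continuous_map_real_mult_left
        continuous_map_real_max continuous_map_real_min)

end

theory Submission
  imports Defs
begin

text \<open>
  Everything rests on a local description of infima in \<open>C(\<Omega>)\<close>: a set of non-negative functions
  has infimum \<open>0\<close> iff on every non-empty open set some member takes arbitrarily small values
  (\<open>is_inf_in_cont_fun_zero_iff\<close>). A lower bound that is positive somewhere exceeds a positive
  constant on an open set; conversely, if all members are at least \<open>\<epsilon>\<close> on an open set, then
  complete regularity supplies a nonzero bump below all of them.

  If \<open>f\<close> uo-converges to \<open>0\<close>, test it against the constant \<open>1\<close>. The dominating net has infimum
  \<open>0\<close>, so one of its members is below \<open>min \<epsilon> 1\<close> at some point of \<open>U\<close>, hence on an open \<open>V \<subseteq> U\<close>.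
  There the truncation \<open>min (f\<^sub>\<alpha>) 1\<close> is eventually below \<open>min \<epsilon> 1\<close>, and so \<open>f\<^sub>\<alpha>\<close> is below \<open>\<epsilon>\<close>.

  Conversely, fix \<open>v \<ge> 0\<close> and dominate \<open>min (f\<^sub>\<alpha>) v\<close> by the family of all its eventual upper
  bounds in \<open>C(\<Omega>)\<close>, which is directed downwards. To see that its infimum is \<open>0\<close>, take \<open>V \<subseteq> U\<close>
  on which \<open>f\<^sub>\<alpha>\<close> is eventually below \<open>\<epsilon>\<close>, and a function \<open>h\<close> that vanishes at a point of \<open>V\<close>
  and equals \<open>1\<close> off \<open>V\<close>. Then \<open>\<epsilon> + h v\<close> is an eventual upper bound, by \<open>\<epsilon>\<close> on \<open>V\<close> and by \<open>v\<close>
  off \<open>V\<close>, and its value at the chosen point is \<open>\<epsilon>\<close>.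
\<close>

lemma extend_by_zero_in_cont_fun:
  assumes "continuous_map X euclideanreal g"
  shows "(\<lambda>t. if t \<in> topspace X then g t else 0) \<in> cont_fun X"
  using continuous_map_eq[OF assms] by (auto simp: cont_fun_def)

lemma openin_cont_fun_less:
  assumes "u \<in> cont_fun X" "openin X U"
  shows "openin X {t \<in> U. u t < c}"
proof -
  have "openin X {t \<in> topspace X. u t \<in> {..<c}}"
    using assms(1) by (intro openin_continuous_map_preimage[where Y = euclideanreal])
      (auto simp: cont_fun_def)
  then have "openin X ({t \<in> topspace X. u t \<in> {..<c}} \<inter> U)"
    using assms(2) by blast
  also have "{t \<in> topspace X. u t \<in> {..<c}} \<inter> U = {t \<in> U. u t < c}"
    using openin_subset[OF assms(2)] by auto
  finally show ?thesis .
qed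

lemma completely_regular_bump:
  assumes "completely_regular_space X" "openin X U" "t0 \<in> U"
  obtains h :: "'a \<Rightarrow> real" where "continuous_map X euclideanreal h"
    "\<And>t. t \<in> topspace X \<Longrightarrow> 0 \<le> h t" "\<And>t. t \<in> topspace X \<Longrightarrow> h t \<le> 1"
    "h t0 = 0" "\<And>t. t \<in> topspace X - U \<Longrightarrow> h t = 1"
proof -
  have "closedin X (topspace X - U)" "t0 \<in> topspace X - (topspace X - U)"
    using assms openin_subset by auto
  then obtain h :: "'a \<Rightarrow> real"
    where h: "continuous_map X (top_of_set {0..1}) h" "h t0 = 0" "h ` (topspace X - U) \<subseteq> {1}"
    using assms(1) unfolding completely_regular_space_def by meson
  show thesis
    using h by (intro that[of h]) (auto simp: continuous_map_in_subtopology)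
qed

text \<open>
  The infimum in \<open>C(\<Omega>)\<close> is not the pointwise one: a lower bound is continuous, so it is positive
  on an open set as soon as it is positive at a point. Hence the members need only be small
  somewhere in each non-empty open set, and their values may stay away from \<open>0\<close> at single points.
\<close>

lemma is_inf_in_cont_fun_zero_iff:
  assumes X: "completely_regular_space X" and D: "D \<subseteq> cont_fun_nonneg X"
  shows "is_inf_in (cont_fun X) D 0 \<longleftrightarrow>
    (\<forall>U \<epsilon>. openin X U \<and> U \<noteq> {} \<and> (0::real) < \<epsilon> \<longrightarrow> (\<exists>d\<in>D. \<exists>t\<in>U. d t < \<epsilon>))"
proof (intro iffI allI impI)
  fix U and \<epsilon> :: real
  assume inf: "is_inf_in (cont_fun X) D 0" and U: "openin X U \<and> U \<noteq> {} \<and> 0 < \<epsilon>"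
  show "\<exists>d\<in>D. \<exists>t\<in>U. d t < \<epsilon>"
  proof (rule ccontr)
    assume neg: "\<not> ?thesis"
    obtain t0 where t0: "t0 \<in> U" using U by blast
    then have t0X: "t0 \<in> topspace X" using U openin_subset by blast
    obtain h where h: "continuous_map X euclideanreal h"
      "\<And>t. t \<in> topspace X \<Longrightarrow> 0 \<le> h t" "\<And>t. t \<in> topspace X \<Longrightarrow> h t \<le> 1"
      "h t0 = 0" "\<And>t. t \<in> topspace X - U \<Longrightarrow> h t = 1"
      using completely_regular_bump[OF X _ t0] U by metis
    define z where "z = (\<lambda>t. if t \<in> topspace X then \<epsilon> * (1 - h t) else 0)"
    have "z \<in> cont_fun X"
      unfolding z_def
      by (intro extend_by_zero_in_cont_fun continuous_map_real_mult continuous_map_diff h) auto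
    moreover have "z \<le> d" if d: "d \<in> D" for d
    proof (rule le_funI)
      fix t
      have d0: "0 \<le> d t" using d D by (auto simp: cont_fun_nonneg_def le_fun_def)
      show "z t \<le> d t"
      proof (cases "t \<in> U")
        case True
        then have "t \<in> topspace X" using U openin_subset by blast
        then have "z t \<le> \<epsilon>" using h(2)[of t] U by (simp add: z_def mult_left_le)
        also have "\<epsilon> \<le> d t" using neg d True by force
        finally show ?thesis .
      next
        case False
        then show ?thesis using d0 h(5)[of t] by (auto simp: z_def)
      qed
    qed
    ultimately have "z \<le> 0" using inf by (auto simp: is_inf_in_def)
    then have "z t0 \<le> 0" by (simp add: le_fun_def)
    then show False using h(4) t0X U by (simp add: z_def)
  qed
next
  assume small: "\<forall>U \<epsilon>. openin X U \<and> U \<noteq> {} \<and> (0::real) < \<epsilon> \<longrightarrow> (\<exists>d\<in>D. \<exists>t\<in>U. d t < \<epsilon>)"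
  have "z \<le> 0" if z: "z \<in> cont_fun X" "\<forall>d\<in>D. z \<le> d" for z
  proof (rule le_funI, rule ccontr)
    fix t0 assume "\<not> z t0 \<le> 0 t0"
    then have pos: "0 < z t0" by simp
    then have t0: "t0 \<in> topspace X" using z(1) by (auto simp: cont_fun_def)
    let ?U = "{t \<in> topspace X. (- z) t < - (z t0 / 2)}"
    have "openin X ?U"
      using z(1) by (intro openin_cont_fun_less cont_fun_vector_sublattice(3)) auto
    moreover have "t0 \<in> ?U" using t0 pos by simp
    ultimately obtain d t where d: "d \<in> D" "t \<in> ?U" "d t < z t0 / 2"
      using small[rule_format, of ?U "z t0 / 2"] pos by (metis (lifting) empty_iff half_gt_zero)
    moreover have "z t \<le> d t" using z(2) d(1) by (auto simp: le_fun_def)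
    ultimately show False by simp
  qed
  moreover have "0 \<in> cont_fun X" by (simp add: cont_fun_def zero_fun_def)
  ultimately show "is_inf_in (cont_fun X) D 0"
    using D by (auto simp: is_inf_in_def cont_fun_nonneg_def)
qed

lemma lattice_abs_of_nonneg:
  fixes x :: "'v::{lattice, ordered_ab_group_add}"
  assumes "0 \<le> x"
  shows "lattice_abs x = x"
proof -
  have "- x \<le> x" using assms by (meson neg_le_0_iff_le order_trans)
  then show ?thesis by (simp add: lattice_abs_def sup_absorb1)
qed

text \<open>
  The reverse order on the eventual upper bounds makes them a decreasing net, indexed by itself;
  directedness of \<open>A\<close> gives that the infimum of two eventual upper bounds is again one.
\<close>

lemma order_converges_zero_by_eventual_bounds:
  fixes g :: "'i \<Rightarrow> 'a \<Rightarrow> real"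
  assumes A: "directed_on A r"
    and nonneg: "\<And>\<alpha>. \<alpha> \<in> A \<Longrightarrow> 0 \<le> g \<alpha>"
    and B_def: "B = {w \<in> cont_fun_nonneg X. \<exists>\<alpha>0\<in>A. \<forall>\<alpha>\<in>A. (\<alpha>0, \<alpha>) \<in> r \<longrightarrow> g \<alpha> \<le> w}"
    and "B \<noteq> {}"
    and inf: "is_inf_in (cont_fun X) B 0"
  shows "order_converges (cont_fun X) A r g 0"
proof -
  let ?s = "{(y, z). y \<in> B \<and> z \<in> B \<and> z \<le> y}"
  have "\<exists>w\<in>B. (y, w) \<in> ?s \<and> (z, w) \<in> ?s" if yz: "y \<in> B" "z \<in> B" for y z
  proof -
    obtain \<alpha>1 \<alpha>2 where 1: "\<alpha>1 \<in> A" "\<forall>\<alpha>\<in>A. (\<alpha>1, \<alpha>) \<in> r \<longrightarrow> g \<alpha> \<le> y"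
      and 2: "\<alpha>2 \<in> A" "\<forall>\<alpha>\<in>A. (\<alpha>2, \<alpha>) \<in> r \<longrightarrow> g \<alpha> \<le> z"
      using yz unfolding B_def by blast
    obtain \<alpha>3 where 3: "\<alpha>3 \<in> A" "(\<alpha>1, \<alpha>3) \<in> r" "(\<alpha>2, \<alpha>3) \<in> r"
      using A 1(1) 2(1) unfolding directed_on_def by blast
    have "trans r" using A by (auto simp: directed_on_def preorder_on_def)
    then have "\<forall>\<alpha>\<in>A. (\<alpha>3, \<alpha>) \<in> r \<longrightarrow> g \<alpha> \<le> inf y z"
      using 1 2 3 by (meson le_infI transD)
    moreover have "inf y z \<in> cont_fun_nonneg X"
      using yz by (auto simp: B_def cont_fun_nonneg_def cont_fun_vector_sublattice)
    ultimately have "inf y z \<in> B" using 3(1) unfolding B_def by blast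
    then show ?thesis using yz by (intro bexI[of _ "inf y z"]) auto
  qed
  then have "directed_on B ?s"
    using \<open>B \<noteq> {}\<close> by (auto simp: directed_on_def preorder_on_def refl_on_def trans_def)
  then have "net_decreasing_to (cont_fun X) B ?s id 0"
    using inf by (auto simp: net_decreasing_to_def B_def cont_fun_nonneg_def)
  moreover have "\<forall>w\<in>B. \<exists>\<alpha>0\<in>A. \<forall>\<alpha>\<in>A. (\<alpha>0, \<alpha>) \<in> r \<longrightarrow> lattice_abs (g \<alpha> - 0) \<le> id w"
    using nonneg by (auto simp: B_def lattice_abs_of_nonneg)
  ultimately show ?thesis by (rule order_convergesI)
qed

lemma small_on_open_subset_if_uo_converges:
  fixes f :: "'i \<Rightarrow> 'a \<Rightarrow> real"
  assumes X: "completely_regular_space X"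
    and nonneg: "\<And>\<alpha>. \<alpha> \<in> A \<Longrightarrow> 0 \<le> f \<alpha>"
    and uo: "uo_converges (cont_fun X) A r f 0"
    and U: "openin X U" "U \<noteq> {}" and \<epsilon>: "(0::real) < \<epsilon>"
  obtains V \<alpha>0 where "\<alpha>0 \<in> A" "openin X V" "V \<noteq> {}" "V \<subseteq> U"
    "\<forall>t\<in>V. \<forall>\<alpha>\<in>A. (\<alpha>0, \<alpha>) \<in> r \<longrightarrow> f \<alpha> t < \<epsilon>"
proof -
  define e :: "'a \<Rightarrow> real" where "e = (\<lambda>t. if t \<in> topspace X then 1 else 0)"
  have e: "e \<in> cont_fun X" unfolding e_def by (rule extend_by_zero_in_cont_fun) simp
  have e0: "0 \<le> e" by (auto simp: e_def le_fun_def)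
  obtain G :: "('a \<Rightarrow> real) set" and s u where u: "net_decreasing_to (cont_fun X) G s u 0"
    and dom: "\<forall>g\<in>G. \<exists>\<alpha>0\<in>A. \<forall>\<alpha>\<in>A. (\<alpha>0, \<alpha>) \<in> r \<longrightarrow>
      lattice_abs (inf (lattice_abs (f \<alpha> - 0)) e - 0) \<le> u g"
    using uo e e0 unfolding uo_converges_def order_converges_def by blast
  have "u ` G \<subseteq> cont_fun_nonneg X" "is_inf_in (cont_fun X) (u ` G) 0"
    using u by (auto simp: net_decreasing_to_def cont_fun_nonneg_def is_inf_in_def)
  then obtain g t where g: "g \<in> G" "t \<in> U" "u g t < min \<epsilon> 1"
    using is_inf_in_cont_fun_zero_iff[OF X, of "u ` G"] U \<epsilon>
    by (metis (no_types, lifting) imageE min_less_iff_conj zero_less_one)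
  obtain \<alpha>0 where \<alpha>0: "\<alpha>0 \<in> A" "\<forall>\<alpha>\<in>A. (\<alpha>0, \<alpha>) \<in> r \<longrightarrow>
      lattice_abs (inf (lattice_abs (f \<alpha> - 0)) e - 0) \<le> u g"
    using dom g(1) by blast
  let ?V = "{t \<in> U. u g t < min \<epsilon> 1}"
  have "f \<alpha> t < \<epsilon>" if t: "t \<in> ?V" and \<alpha>: "\<alpha> \<in> A" "(\<alpha>0, \<alpha>) \<in> r" for t \<alpha>
  proof -
    have "lattice_abs (f \<alpha> - 0) = f \<alpha>" "0 \<le> inf (f \<alpha>) e"
      using nonneg[OF \<alpha>(1)] e0 by (simp_all add: lattice_abs_of_nonneg)
    then have "inf (f \<alpha>) e \<le> u g"
      using \<alpha>0(2)[rule_format, OF \<alpha>] by (simp only: diff_zero lattice_abs_of_nonneg)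
    then have "min (f \<alpha> t) (e t) \<le> u g t"
      by (auto simp: le_fun_def inf_real_def)
    moreover have "e t = 1" using t openin_subset[OF U(1)] by (auto simp: e_def)
    ultimately show ?thesis using t by auto
  qed
  moreover have "openin X ?V"
    using u g(1) U(1) by (intro openin_cont_fun_less) (auto simp: net_decreasing_to_def)
  ultimately show thesis using g \<alpha>0(1) by (intro that[of \<alpha>0 ?V]) auto
qed

lemma uo_converges_if_small_on_open_subsets:
  fixes f :: "'i \<Rightarrow> 'a \<Rightarrow> real"
  assumes X: "completely_regular_space X" and A: "directed_on A r"
    and f: "\<And>\<alpha>. \<alpha> \<in> A \<Longrightarrow> f \<alpha> \<in> cont_fun_nonneg X"
    and small: "\<And>U \<epsilon>. openin X U \<Longrightarrow> U \<noteq> {} \<Longrightarrow> (0::real) < \<epsilon> \<Longrightarrow>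
      \<exists>V. \<exists>\<alpha>0\<in>A. openin X V \<and> V \<noteq> {} \<and> V \<subseteq> U \<and>
        (\<forall>t\<in>V. \<forall>\<alpha>\<in>A. (\<alpha>0, \<alpha>) \<in> r \<longrightarrow> f \<alpha> t < \<epsilon>)"
  shows "uo_converges (cont_fun X) A r f 0"
  unfolding uo_converges_def
proof (intro ballI impI)
  fix v assume v: "v \<in> cont_fun X" "0 \<le> v"
  define g where "g = (\<lambda>\<alpha>. inf (lattice_abs (f \<alpha> - 0)) v)"
  have f0: "0 \<le> f \<alpha>" if "\<alpha> \<in> A" for \<alpha>
    using f[OF that] by (simp add: cont_fun_nonneg_def)
  have g: "g \<alpha> = inf (f \<alpha>) v" if "\<alpha> \<in> A" for \<alpha>
    using f0[OF that] by (simp add: g_def lattice_abs_of_nonneg)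
  define B where
    "B = {w \<in> cont_fun_nonneg X. \<exists>\<alpha>0\<in>A. \<forall>\<alpha>\<in>A. (\<alpha>0, \<alpha>) \<in> r \<longrightarrow> g \<alpha> \<le> w}"
  have "v \<in> B"
    using v A by (auto simp: B_def cont_fun_nonneg_def g directed_on_def)
  have inf: "is_inf_in (cont_fun X) B 0"
  proof (subst is_inf_in_cont_fun_zero_iff[OF X])
    show "B \<subseteq> cont_fun_nonneg X" by (auto simp: B_def)
    show "\<forall>U \<epsilon>. openin X U \<and> U \<noteq> {} \<and> (0::real) < \<epsilon> \<longrightarrow> (\<exists>w\<in>B. \<exists>t\<in>U. w t < \<epsilon>)"
    proof (intro allI impI)
      fix U and \<epsilon> :: real
      assume U: "openin X U \<and> U \<noteq> {} \<and> 0 < \<epsilon>"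
      \<comment> \<open>Half of \<open>\<epsilon>\<close>, because the bound built below attains this constant and must stay
        strictly below \<open>\<epsilon>\<close>.\<close>
      then obtain V \<alpha>0 where \<alpha>0: "\<alpha>0 \<in> A" and V: "openin X V" "V \<noteq> {}" "V \<subseteq> U"
        and fV: "\<And>t \<alpha>. t \<in> V \<Longrightarrow> \<alpha> \<in> A \<Longrightarrow> (\<alpha>0, \<alpha>) \<in> r \<Longrightarrow> f \<alpha> t < \<epsilon> / 2"
        using small[of U "\<epsilon> / 2"] by (metis half_gt_zero)
      obtain t0 where t0: "t0 \<in> V" using V by blast
      then have t0X: "t0 \<in> topspace X" using V openin_subset by blast
      obtain h where h: "continuous_map X euclideanreal h"
        "\<And>t. t \<in> topspace X \<Longrightarrow> 0 \<le> h t" "\<And>t. t \<in> topspace X \<Longrightarrow> h t \<le> 1"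
        "h t0 = 0" "\<And>t. t \<in> topspace X - V \<Longrightarrow> h t = 1"
        using completely_regular_bump[OF X V(1) t0] by metis
      define w where "w = (\<lambda>t. if t \<in> topspace X then \<epsilon> / 2 + h t * v t else 0)"
      have "continuous_map X euclideanreal v" using v(1) by (simp add: cont_fun_def)
      then have "w \<in> cont_fun X"
        unfolding w_def
        by (intro extend_by_zero_in_cont_fun continuous_map_real_mult continuous_map_add h) auto
      moreover have v0: "0 \<le> v t" for t using v(2) by (simp add: le_fun_def)
      have "0 \<le> w"
        using v0 h(2) U by (auto simp: w_def le_fun_def)
      moreover have "g \<alpha> \<le> w" if \<alpha>: "\<alpha> \<in> A" "(\<alpha>0, \<alpha>) \<in> r" for \<alpha>
      proof (rule le_funI)
        fix t
        have gt: "g \<alpha> t = min (f \<alpha> t) (v t)" using g[OF \<alpha>(1)] by (simp add: inf_real_def)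
        consider "t \<in> V" | "t \<in> topspace X - V" | "t \<notin> topspace X" by blast
        then show "g \<alpha> t \<le> w t"
        proof cases
          case 1
          then have "t \<in> topspace X" using V openin_subset by blast
          then have "\<epsilon> / 2 \<le> w t" using v0 h(2) by (simp add: w_def)
          then show ?thesis using fV[OF 1 \<alpha>] gt by linarith
        next
          case 2
          then have "w t = \<epsilon> / 2 + v t" using h(5) by (simp add: w_def)
          then show ?thesis using U gt by linarith
        next
          case 3
          then have "v t = 0" using v(1) by (simp add: cont_fun_def)
          then show ?thesis using 3 gt by (simp add: w_def)
        qed
      qed
      ultimately have "w \<in> B" using \<alpha>0 by (auto simp: B_def cont_fun_nonneg_def)
      moreover have "w t0 < \<epsilon>" using h(4) t0X U by (simp add: w_def)
      ultimately show "\<exists>w\<in>B. \<exists>t\<in>U. w t < \<epsilon>" using t0 V(3) by blast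
    qed
  qed
  have "0 \<le> g \<alpha>" if "\<alpha> \<in> A" for \<alpha> using f0[OF that] v(2) by (simp add: g[OF that])
  then have "order_converges (cont_fun X) A r g 0"
    using order_converges_zero_by_eventual_bounds[OF A _ B_def _ inf] \<open>v \<in> B\<close> by blast
  then show "order_converges (cont_fun X) A r (\<lambda>\<alpha>. inf (lattice_abs (f \<alpha> - 0)) v) 0"
    by (simp add: g_def)
qed

theorem theorem3p2:
  fixes X :: "'a topology" and A :: "'i set" and r :: "'i rel" and f :: "'i \<Rightarrow> 'a \<Rightarrow> real"
  assumes "completely_regular_space X" and "Hausdorff_space X"
    and "directed_on A r"
    and "\<And>\<alpha>. \<alpha> \<in> A \<Longrightarrow> f \<alpha> \<in> cont_fun_nonneg X"
  shows "uo_converges (cont_fun X) A r f 0 \<longleftrightarrow>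
    (\<forall>U \<epsilon>. openin X U \<and> U \<noteq> {} \<and> (0::real) < \<epsilon> \<longrightarrow>
      (\<exists>V. \<exists>\<alpha>0\<in>A. openin X V \<and> V \<noteq> {} \<and> V \<subseteq> U \<and>
        (\<forall>t\<in>V. \<forall>\<alpha>\<in>A. (\<alpha>0, \<alpha>) \<in> r \<longrightarrow> f \<alpha> t < \<epsilon>)))"
proof (intro iffI allI impI)
  fix U and \<epsilon> :: real
  assume uo: "uo_converges (cont_fun X) A r f 0" and U: "openin X U \<and> U \<noteq> {} \<and> 0 < \<epsilon>"
  have "0 \<le> f \<alpha>" if "\<alpha> \<in> A" for \<alpha>
    using assms(4)[OF that] by (simp add: cont_fun_nonneg_def)
  then obtain V \<alpha>0 where "\<alpha>0 \<in> A" "openin X V" "V \<noteq> {}" "V \<subseteq> U"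
    "\<forall>t\<in>V. \<forall>\<alpha>\<in>A. (\<alpha>0, \<alpha>) \<in> r \<longrightarrow> f \<alpha> t < \<epsilon>"
    using small_on_open_subset_if_uo_converges[OF assms(1) _ uo] U by metis
  then show "\<exists>V. \<exists>\<alpha>0\<in>A. openin X V \<and> V \<noteq> {} \<and> V \<subseteq> U \<and>
      (\<forall>t\<in>V. \<forall>\<alpha>\<in>A. (\<alpha>0, \<alpha>) \<in> r \<longrightarrow> f \<alpha> t < \<epsilon>)"
    by blast
next
  assume "\<forall>U \<epsilon>. openin X U \<and> U \<noteq> {} \<and> (0::real) < \<epsilon> \<longrightarrow>
      (\<exists>V. \<exists>\<alpha>0\<in>A. openin X V \<and> V \<noteq> {} \<and> V \<subseteq> U \<and>
        (\<forall>t\<in>V. \<forall>\<alpha>\<in>A. (\<alpha>0, \<alpha>) \<in> r \<longrightarrow> f \<alpha> t < \<epsilon>))"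
  then show "uo_converges (cont_fun X) A r f 0"
    using assms(1,3,4) by (intro uo_converges_if_small_on_open_subsets) auto
qed

end
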